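(* Let $\rho$ be a quasi-distance on $\mathbb{R}^n$ which is quasi-convex and $1$-Ahlfors-regular. Then $\rho$ satisfies the inner property: there exist constants $a,b>0$ such that for all $x\in\mathbb{R}^n$, $r>0$ and $\lambda\ge1$, $$a\lambda^b\,(B_\rho(x,r)-x)\subseteq B_\rho(x,\lambda r)-x.$$
   Context: $|E|$ denotes Lebesgue measure of $E\subseteq\mathbb{R}^n$, and $\mathbb{B}^n$ is the closed Euclidean unit ball. An ellipsoid is a set $\xi=M(\mathbb{B}^n)+c$ with $M$ a nonsingular real $n\times n$ matrix and $c\in\mathbb{R}^n$ its center; for $\lambda>0$, $\lambda\cdot\xi:=\lambda M(\mathbb{B}^n)+c$. For a set $E\subseteq \mathbb{R}^n$, $x\in\mathbb{R}^n$ and $\mu>0$: $E-x=\{y-x:y\in E\}$, $\mu E=\{\mu y:y\in E\}$. A quasi-distance on $\mathbb{R}^n$ is a map $\rho:\mathbb{R}^n\times\mathbb{R}^n\to[0,\infty)$ for which there is $\kappa\ge1$ such that for all $x,y,z$: $\rho(x,y)=0\Leftrightarrow x=y$; $\rho(x,y)=\rho(y,x)$; $\rho(x,z)\le\kappa(\rho(x,y)+\rho(y,z))$. Its balls are $B_\rho(x,r)=\{y\in\mathbb{R}^n:\rho(x,y)<r\}$. $\rho$ is quasi-convex if there is $Q\ge1$ such that for all $x\in\mathbb{R}^n$, $r>0$ there is an ellipsoid $\xi_x^r$ with center $x$ and $\xi_x^r\subseteq B_\rho(x,r)\subseteq Q\cdot\xi_x^r$. $\rho$ is $1$-Ahlfors-regular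 if there is $c_1\ge1$ with $\frac1{c_1}r\le|B_\rho(x,r)|\le c_1r$ for all $x\in\mathbb{R}^n$, $r>0$. *)

theory Defs
  imports "HOL-Analysis.Analysis"
begin

definition quasi_distance :: "('a \<Rightarrow> 'a \<Rightarrow> real) \<Rightarrow> bool" where
  "quasi_distance \<rho> \<longleftrightarrow>
     (\<forall>x y. 0 \<le> \<rho> x y) \<and>
     (\<exists>\<kappa>\<ge>1. \<forall>x y z.
        (\<rho> x y = 0 \<longleftrightarrow> x = y) \<and>
        \<rho> x y = \<rho> y x \<and>
        \<rho> x z \<le> \<kappa> * (\<rho> x y + \<rho> y z))"

definition qball :: "('a \<Rightarrow> 'a \<Rightarrow> real) \<Rightarrow> 'a \<Rightarrow> real \<Rightarrow> 'a set" where
  "qball \<rho> x r = {y. \<rho> x y < r}"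

definition ellipsoid :: "real^'n^'n \<Rightarrow> real^'n \<Rightarrow> (real^'n) set" where
  "ellipsoid M c = (\<lambda>y. M *v y + c) ` cball 0 1"

text \<open>The dilation of \<open>ellipsoid M c\<close> by the factor \<open>l\<close> about its own center \<open>c\<close>. As a set it
  depends only on \<open>l\<close> and the set \<open>ellipsoid M c\<close>, not on the choice of \<open>M\<close>.\<close>

definition dilated_ellipsoid :: "real \<Rightarrow> real^'n^'n \<Rightarrow> real^'n \<Rightarrow> (real^'n) set" where
  "dilated_ellipsoid l M c = (\<lambda>y. l *\<^sub>R (M *v y) + c) ` cball 0 1"

definition quasi_convex :: "(real^'n \<Rightarrow> real^'n \<Rightarrow> real) \<Rightarrow> bool" where
  "quasi_convex \<rho> \<longleftrightarrow>
     (\<exists>Q\<ge>1. \<forall>x. \<forall>r>0. \<exists>M :: real^'n^'n. invertible M \<and>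
        ellipsoid M x \<subseteq> qball \<rho> x r \<and>
        qball \<rho> x r \<subseteq> dilated_ellipsoid Q M x)"

text \<open>Balls of a quasi-distance need not be open, or even measurable, in general. The condition
  on \<open>|B\<^sub>\<rho>(x,r)|\<close> includes that this measure is defined and finite. \<open>measure\<close> is \<open>0\<close> on
  non-measurable sets and on sets of infinite measure, so the lower bound would imply the
  membership in \<open>lmeasurable\<close> anyway.\<close>

definition Ahlfors_regular_1 :: "(real^'n \<Rightarrow> real^'n \<Rightarrow> real) \<Rightarrow> bool" where
  "Ahlfors_regular_1 \<rho> \<longleftrightarrow>
     (\<exists>c1\<ge>1. \<forall>x. \<forall>r>0.
        qball \<rho> x r \<in> lmeasurable \<and>
        1 / c1 * r \<le> measure lebesgue (qball \<rho> x r) \<and>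
        measure lebesgue (qball \<rho> x r) \<le> c1 * r)"

definition inner_property :: "(real^'n \<Rightarrow> real^'n \<Rightarrow> real) \<Rightarrow> bool" where
  "inner_property \<rho> \<longleftrightarrow>
     (\<exists>a>0. \<exists>b>0. \<forall>x. \<forall>r>0. \<forall>l\<ge>1.
        (\<lambda>y. (a * l powr b) *\<^sub>R y) ` ((\<lambda>y. y - x) ` qball \<rho> x r)
          \<subseteq> (\<lambda>y. y - x) ` qball \<rho> x (l * r))"

end

theory Submission
  imports Defs
begin

text \<open>Let \<open>v\<close> lie in the body \<open>S x r\<close> of the inner ellipsoid at \<open>x\<close>, so that \<open>x + v\<close> and \<open>x - v\<close>
  lie in the ball \<open>B x r\<close>. If \<open>z \<in> B x s\<close> with \<open>s \<ge> r\<close>, then \<open>B z (2\<kappa>s)\<close> contains \<open>x + v\<close> and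
  \<open>x - v\<close> as well, hence by symmetry and convexity \<open>S z (2\<kappa>s)\<close> contains half their difference
  divided by \<open>Q\<close>, that is \<open>v / Q\<close>. One can therefore walk from \<open>x\<close> in steps \<open>v / Q\<close> whose length
  does not deteriorate, while the radius grows by a constant factor per step. After at least
  \<open>2Q\<^sup>2\<close> steps this yields \<open>2 S x r \<subseteq> S x (Lr)\<close> for a constant \<open>L\<close>, and iterating this inclusion
  gives the power law.\<close>

locale quasi_convex_body =
  fixes \<rho> :: "'a::real_vector \<Rightarrow> 'a \<Rightarrow> real" and \<kappa> Q :: real
    and S :: "'a \<Rightarrow> real \<Rightarrow> 'a set"
  assumes kappa: "1 \<le> \<kappa>" and Q: "1 \<le> Q"
    and refl: "\<rho> x x = 0"
    and commute: "\<rho> x y = \<rho> y x"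
    and triangle: "\<rho> x z \<le> \<kappa> * (\<rho> x y + \<rho> y z)"
    and convex_body: "convex (S x r)"
    and zero_body: "0 \<in> S x r"
    and uminus_body: "v \<in> S x r \<Longrightarrow> - v \<in> S x r"
    and inner_body: "0 < r \<Longrightarrow> v \<in> S x r \<Longrightarrow> \<rho> x (x + v) < r"
    and outer_body: "0 < r \<Longrightarrow> \<rho> x y < r \<Longrightarrow> (1 / Q) *\<^sub>R (y - x) \<in> S x r"
begin

lemma scaleR_body: "t *\<^sub>R v \<in> S x r" if "v \<in> S x r" "0 \<le> t" "t \<le> 1"
  using convexD[OF convex_body that(1) zero_body[of x r], of t "1 - t"] that by simp

lemma half_diff_body: "(1 / 2) *\<^sub>R (u - w) \<in> S x r" if "u \<in> S x r" "w \<in> S x r"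
  using convexD[OF convex_body that(1) uminus_body[OF that(2)], of "1/2" "1/2"]
  by (simp add: scaleR_diff_right)

text \<open>Growth of the radius in one step: a point at distance below \<open>s\<close> followed by
  a step of length below \<open>2 * \<kappa> * s\<close> stays within
  \<open>\<kappa> * (s + 2 * \<kappa> * s)\<close>.\<close>

definition C :: real where "C = \<kappa> * (1 + 2 * \<kappa>)"

lemma C_ge: "3 \<le> C"
proof -
  have "1 * 3 \<le> \<kappa> * (1 + 2 * \<kappa>)"
    using kappa by (intro mult_mono) auto
  then show ?thesis by (simp add: C_def)
qed

text \<open>The offset \<open>x - z\<close> cancels in the half difference, so the factor
  \<open>1 / Q\<close> is the same for every \<open>z\<close> in the larger ball.\<close>

lemma common_step:
  assumes r: "0 < r" "r \<le> s" and v: "v \<in> S x r" and z: "\<rho> x z < s"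
  shows "(1 / Q) *\<^sub>R v \<in> S z (2 * \<kappa> * s)"
proof -
  have s: "0 < 2 * \<kappa> * s" using r kappa by simp
  have near: "\<rho> z w < 2 * \<kappa> * s" if "\<rho> x w < s" for w
  proof -
    have "\<rho> z w \<le> \<kappa> * (\<rho> x z + \<rho> x w)"
      using triangle[of z w x] commute[of z x] by simp
    also have "\<dots> < \<kappa> * (s + s)"
      using kappa z that by (intro mult_strict_left_mono) auto
    finally show ?thesis by simp
  qed
  have "\<rho> x (x + v) < s" "\<rho> x (x + - v) < s"
    using inner_body[OF r(1) v] inner_body[OF r(1) uminus_body[OF v]] r(2) by linarith+
  then have "(1 / Q) *\<^sub>R (x + v - z) \<in> S z (2 * \<kappa> * s)"
    and "(1 / Q) *\<^sub>R (x + - v - z) \<in> S z (2 * \<kappa> * s)"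
    using near s by (blast intro: outer_body)+
  from half_diff_body[OF this]
  have "(1 / 2) *\<^sub>R ((1 / Q) *\<^sub>R (2 *\<^sub>R v)) \<in> S z (2 * \<kappa> * s)"
    by (simp add: scaleR_diff_right[symmetric] scaleR_2)
  then show ?thesis by simp
qed

lemma walk:
  assumes r: "0 < r" and v: "v \<in> S x r"
  shows "\<rho> x (x + (real n / Q) *\<^sub>R v) < C ^ n * r"
proof (induction n)
  case 0
  show ?case using r by (simp add: refl)
next
  case (Suc n)
  define z where "z = x + (real n / Q) *\<^sub>R v"
  define s where "s = C ^ n * r"
  \<comment> \<open>Each step applies \<open>common_step\<close> to the original
    \<open>v \<in> S x r\<close>, not to the previous step; this needs
    \<open>r \<le> s\<close>.\<close>
  have "1 \<le> C ^ n" using C_ge by simp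
  then have s: "r \<le> s" "0 < 2 * \<kappa> * s" using r kappa by (simp_all add: s_def)
  have z: "\<rho> x z < s" using Suc by (simp add: z_def s_def)
  have "\<rho> z (z + (1 / Q) *\<^sub>R v) < 2 * \<kappa> * s"
    by (rule inner_body[OF s(2) common_step[OF r s(1) v z]])
  with z kappa have "\<kappa> * (\<rho> x z + \<rho> z (z + (1 / Q) *\<^sub>R v)) < \<kappa> * (s + 2 * \<kappa> * s)"
    by (intro mult_strict_left_mono) auto
  also have "\<dots> = C ^ Suc n * r"
    by (simp add: C_def s_def algebra_simps)
  finally have "\<rho> x (z + (1 / Q) *\<^sub>R v) < C ^ Suc n * r"
    using triangle[of x "z + (1 / Q) *\<^sub>R v" z] by linarith
  moreover have "z + (1 / Q) *\<^sub>R v = x + (real (Suc n) / Q) *\<^sub>R v"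
    by (simp add: z_def scaleR_add_left[symmetric] add_divide_distrib add.commute)
  ultimately show ?case by simp
qed

text \<open>The exponent is the number of steps: \<open>N\<close> steps of \<open>v / Q\<close>
  reach \<open>(N / Q) *\<^sub>R v\<close>, and returning to a body by \<open>outer_body\<close>
  costs another \<open>Q\<close>, so \<open>N \<ge> 2 * Q\<^sup>2\<close> leaves a factor of at
  least 2.\<close>

definition L :: real where "L = C ^ nat \<lceil>2 * Q\<^sup>2\<rceil>"

lemma L_gt: "1 < L"
proof -
  have "1 \<le> Q\<^sup>2" using Q by simp
  then have "nat \<lceil>2 * Q\<^sup>2\<rceil> \<noteq> 0" by linarith
  then show ?thesis unfolding L_def using C_ge by (intro one_less_power) auto
qed

lemma double_body:
  assumes r: "0 < r" and v: "v \<in> S x r"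
  shows "2 *\<^sub>R v \<in> S x (L * r)"
proof -
  define N where "N = nat \<lceil>2 * Q\<^sup>2\<rceil>"
  have N: "2 * Q\<^sup>2 \<le> real N" by (simp add: N_def real_nat_ceiling_ge)
  have Q2: "0 < Q\<^sup>2" using Q by simp
  then have N0: "0 < real N" using N by linarith
  have "0 < L * r" using L_gt r by simp
  from outer_body[OF this walk[OF r v, of N, folded L_def[folded N_def]]]
  have "(real N / Q\<^sup>2) *\<^sub>R v \<in> S x (L * r)"
    by (simp add: power2_eq_square)
  \<comment> \<open>Shrink the factor \<open>N / Q\<^sup>2\<close> to exactly 2.\<close>
  from scaleR_body[OF this, of "2 * Q\<^sup>2 / real N"] show ?thesis
    using N N0 Q2 by simp
qed

lemma power_body:
  assumes r: "0 < r" and v: "v \<in> S x r"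
  shows "(2 ^ k) *\<^sub>R v \<in> S x (L ^ k * r)"
proof (induction k)
  case (Suc k)
  have "0 < L ^ k * r" using L_gt r by simp
  from double_body[OF this Suc] show ?case by (simp add: mult.assoc)
qed (use v in simp)

text \<open>The exponent \<open>log L 2\<close> records one doubling per factor \<open>L\<close> of
  the radius. In \<open>1 / (2 * Q)\<close>, the \<open>Q\<close> comes from
  \<open>outer_body\<close> and the 2 from rounding \<open>l\<close> down to a power of
  \<open>L\<close>.\<close>

lemma power_law:
  assumes r: "0 < r" and l: "1 \<le> l" and y: "\<rho> x y < r"
  shows "\<rho> x (x + (1 / (2 * Q) * l powr log L 2) *\<^sub>R (y - x)) < l * r"
proof -
  obtain k where k: "L ^ k \<le> l" "l < L ^ Suc k"
  proof -
    define k where "k = nat \<lfloor>log L l\<rfloor>"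
    have "0 \<le> log L l" using L_gt l by simp
    then have "real k \<le> log L l" "log L l < real (Suc k)"
      unfolding k_def by linarith+
    then have "L powr real k \<le> l" "l < L powr real (Suc k)"
      using L_gt l by (simp_all add: le_log_iff log_less_iff)
    then show thesis using that L_gt by (simp only: powr_realpow)
  qed
  have "l powr log L 2 \<le> (L powr real (Suc k)) powr log L 2"
    using k l L_gt by (intro powr_mono2) (auto simp: powr_realpow simp del: of_nat_Suc power_Suc)
  also have "\<dots> = (L powr log L 2) powr real (Suc k)"
    by (simp only: powr_powr mult.commute)
  also have "\<dots> = 2 * 2 ^ k"
    using L_gt by (simp add: powr_realpow del: of_nat_Suc)
  finally have t: "l powr log L 2 / (2 * 2 ^ k) \<le> 1" by simp
  have Lr: "0 < L ^ k * r" using L_gt r by simp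
  have "(2 ^ k) *\<^sub>R ((1 / Q) *\<^sub>R (y - x)) \<in> S x (L ^ k * r)"
    using power_body[OF r outer_body[OF r y]] .
  \<comment> \<open>The scalar bounded in \<open>t\<close>, times \<open>2 ^ k / Q\<close>, is the
    desired factor.\<close>
  from scaleR_body[OF this _ t]
  have "(1 / (2 * Q) * l powr log L 2) *\<^sub>R (y - x) \<in> S x (L ^ k * r)"
    by (simp add: mult.commute)
  from inner_body[OF Lr this]
  have "\<rho> x (x + (1 / (2 * Q) * l powr log L 2) *\<^sub>R (y - x)) < L ^ k * r" .
  also have "\<dots> \<le> l * r" using k(1) r by simp
  finally show ?thesis .
qed

end

theorem theorem4p8:
  fixes \<rho> :: "real^'n \<Rightarrow> real^'n \<Rightarrow> real"
  assumes "quasi_distance \<rho>"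
    and "quasi_convex \<rho>"
    and "Ahlfors_regular_1 \<rho>"
  shows "inner_property \<rho>"
proof -
  obtain \<kappa> where \<kappa>: "1 \<le> \<kappa>" "\<And>x. \<rho> x x = 0" "\<And>x y. \<rho> x y = \<rho> y x"
      "\<And>x y z. \<rho> x z \<le> \<kappa> * (\<rho> x y + \<rho> y z)"
    using assms(1) unfolding quasi_distance_def by metis
  obtain Q where Q: "1 \<le> Q"
    and "\<forall>x. \<forall>r>0. \<exists>M :: real^'n^'n. invertible M \<and>
        ellipsoid M x \<subseteq> qball \<rho> x r \<and> qball \<rho> x r \<subseteq> dilated_ellipsoid Q M x"
    using assms(2) unfolding quasi_convex_def by blast
  then obtain M :: "real^'n \<Rightarrow> real \<Rightarrow> real^'n^'n" where
    M: "\<And>x r. 0 < r \<Longrightarrow> ellipsoid (M x r) x \<subseteq> qball \<rho> x r"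
       "\<And>x r. 0 < r \<Longrightarrow> qball \<rho> x r \<subseteq> dilated_ellipsoid Q (M x r) x"
    by metis
  \<comment> \<open>The inner ellipsoid translated to the origin: a linear image of the unit ball,
    hence convex and symmetric.\<close>
  define S where "S x r = (*v) (M x r) ` cball 0 1" for x r
  interpret quasi_convex_body \<rho> \<kappa> Q S
  proof
    fix x y v :: "real^'n" and r :: real
    show "convex (S x r)"
      unfolding S_def by (intro convex_linear_image convex_cball) simp
    show "0 \<in> S x r"
      unfolding S_def by (intro image_eqI[of _ _ 0]) auto
    show "- v \<in> S x r" if v: "v \<in> S x r"
    proof -
      obtain u where "u \<in> cball 0 1" "v = M x r *v u" using v unfolding S_def by blast
      then show ?thesis unfolding S_def
        by (intro image_eqI[of _ _ "- u"]) (auto simp: linear_neg[OF matrix_vector_mul_linear])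
    qed
    show "\<rho> x (x + v) < r" if "0 < r" "v \<in> S x r"
    proof -
      have "x + v \<in> ellipsoid (M x r) x"
        using that(2) unfolding S_def ellipsoid_def by (auto simp: add.commute)
      then show ?thesis using M(1)[OF that(1)] by (auto simp: qball_def)
    qed
    show "(1 / Q) *\<^sub>R (y - x) \<in> S x r" if "0 < r" "\<rho> x y < r"
    proof -
      have "y \<in> dilated_ellipsoid Q (M x r) x"
        using M(2)[OF that(1)] that(2) by (auto simp: qball_def)
      then show ?thesis using Q unfolding dilated_ellipsoid_def S_def by auto
    qed
  qed (use \<kappa> Q in auto)
  let ?a = "1 / (2 * Q)" and ?b = "log L 2"
  have "(?a * l powr ?b) *\<^sub>R (y - x) \<in> (\<lambda>y. y - x) ` qball \<rho> x (l * r)"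
    if "0 < r" "1 \<le> l" "y \<in> qball \<rho> x r" for x y r l
    using power_law[OF that(1,2), of x y] that(3)
    by (intro image_eqI[of _ _ "x + (?a * l powr ?b) *\<^sub>R (y - x)"]) (auto simp: qball_def)
  moreover have "0 < ?a" "0 < ?b" using Q L_gt by auto
  ultimately show ?thesis unfolding inner_property_def by blast
qed

end
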